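(* Let $G=(V,\mathcal E,w)$ be an undirected, connected, weighted graph on $n$ nodes with Laplacian $L$, diagonal weighted-degree matrix $\Delta$, and largest Laplacian eigenvalue $\lambda_n$. Let $\tau\ge0$ with $\tau\lambda_n<\pi/2$. Consider the consensus network with receiver noise $$\dot x_i=\sum_{j\ne i}a_{ij}\big((x_j(t-\tau)+\xi_i(t))-x_i(t-\tau)\big),\qquad i\in V,$$ that is, $$\dot x(t)=-L\,x(t-\tau)+\Delta\,\xi(t),\qquad y=M_nx,$$ where $\xi_1,\dots,\xi_n$ are mutually independent zero-mean Gaussian white noises with intensities $\sigma_1^2,\dots,\sigma_n^2$. Then for every agent $i\in V$, $$\eta_i=\frac12\Big[\Delta^2L^{\dagger}\cos(\tau L)\big(M_n-\sin(\tau L)\big)^{\dagger}\Big]_{ii}.$$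
   Context: Notation: - $a_{ij}$ are the weighted adjacency entries. - $M_n=I_n-\frac1n\mathbf1\mathbf1^T$. - $X^\dagger$ is the Moore–Penrose pseudo-inverse. - $\cos(X)$ and $\sin(X)$ are the matrix power-series functions. The performance is $$\rho_{ss}=\lim_{t\to\infty}\mathbb E[y^Ty]=\frac1{2\pi}\int\mathrm{Tr}[G(j\omega)^HG(j\omega)]d\omega,\qquad G(s)=M_n(sI+e^{-\tau s}L)^{-1}\Delta\,\mathrm{diag}(\sigma_1,\dots,\sigma_n).$$ The centrality index of agent $i$ is $\eta_i=\partial\rho_{ss}/\partial\sigma_i^2$. *)

theory Defs
  imports "HOL-Analysis.Analysis"
begin

section \<open>Matrices over a finite index type 'n (the n agents)\<close>

text \<open>Matrix power w.r.t. the matrix product (note: (^) on vec types is entrywise).\<close>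
primrec mpow :: "'a::semiring_1^'n::finite^'n \<Rightarrow> nat \<Rightarrow> 'a^'n^'n" where
  "mpow X 0 = mat 1"
| "mpow X (Suc k) = X ** mpow X k"

text \<open>Matrix cosine and sine as power series, entrywise.\<close>
definition mcos :: "real^'n::finite^'n \<Rightarrow> real^'n^'n" where
  "mcos X = (\<chi> i j. (\<Sum>k. ((-1)^k / fact (2*k)) * (mpow X (2*k)) $ i $ j))"

definition msin :: "real^'n::finite^'n \<Rightarrow> real^'n^'n" where
  "msin X = (\<chi> i j. (\<Sum>k. ((-1)^k / fact (2*k+1)) * (mpow X (2*k+1)) $ i $ j))"

text \<open>Moore--Penrose pseudo-inverse (the unique matrix satisfying the Penrose equations).\<close>
definition pinv :: "real^'n::finite^'n \<Rightarrow> real^'n^'n" where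
  "pinv X = (THE Y. X ** Y ** X = X \<and> Y ** X ** Y = Y \<and>
                    transpose (X ** Y) = X ** Y \<and> transpose (Y ** X) = Y ** X)"

definition diagm :: "('n::finite \<Rightarrow> 'a::zero) \<Rightarrow> 'a^'n^'n" where
  "diagm d = (\<chi> i j. if i = j then d i else 0)"

section \<open>Weighted graphs\<close>

text \<open>Undirected weighted graph given by symmetric nonnegative adjacency weights,
  no self loops; edges are pairs with positive weight.\<close>
definition weighted_graph :: "('n::finite \<Rightarrow> 'n \<Rightarrow> real) \<Rightarrow> bool" where
  "weighted_graph a \<longleftrightarrow> (\<forall>i j. a i j = a j i \<and> a i j \<ge> 0) \<and> (\<forall>i. a i i = 0)"

definition graph_connected :: "('n::finite \<Rightarrow> 'n \<Rightarrow> real) \<Rightarrow> bool" where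
  "graph_connected a \<longleftrightarrow> (\<forall>i j. (i, j) \<in> {(u, v). a u v > 0}\<^sup>*)"

definition degm :: "('n::finite \<Rightarrow> 'n \<Rightarrow> real) \<Rightarrow> real^'n^'n" where
  "degm a = diagm (\<lambda>i. \<Sum>j\<in>UNIV. a i j)"

definition adjm :: "('n::finite \<Rightarrow> 'n \<Rightarrow> real) \<Rightarrow> real^'n^'n" where
  "adjm a = (\<chi> i j. a i j)"

definition laplacian :: "('n::finite \<Rightarrow> 'n \<Rightarrow> real) \<Rightarrow> real^'n^'n" where
  "laplacian a = degm a - adjm a"

text \<open>Largest eigenvalue of a (real symmetric) matrix.\<close>
definition lambda_max :: "real^'n::finite^'n \<Rightarrow> real" where
  "lambda_max X = Max {e. \<exists>v. v \<noteq> 0 \<and> X *v v = e *\<^sub>R v}"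

text \<open>Centering matrix M_n = I - (1/n) 1 1^T.\<close>
definition centering :: "real^'n::finite^'n" where
  "centering = (\<chi> i j. (if i = j then 1 else 0) - 1 / real CARD('n))"

section \<open>H2 performance and centrality\<close>

definition cmat :: "real^'n::finite^'n \<Rightarrow> complex^'n^'n" where
  "cmat X = map_matrix complex_of_real X"

text \<open>Transfer matrix G(s) = M_n (sI + e^{-tau s} L)^{-1} Delta diag(sigma).\<close>
definition transfer :: "('n::finite \<Rightarrow> 'n \<Rightarrow> real) \<Rightarrow> real \<Rightarrow> real^'n \<Rightarrow> complex \<Rightarrow> complex^'n^'n" where
  "transfer a \<tau> \<sigma> s =
     cmat centering ** matrix_inv (mat s + mat (exp (- complex_of_real \<tau> * s)) ** cmat (laplacian a))
       ** cmat (degm a) ** cmat (diagm (\<lambda>i. \<sigma> $ i))"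

definition conj_transpose :: "complex^'n::finite^'m::finite \<Rightarrow> complex^'m^'n" where
  "conj_transpose X = map_matrix cnj (transpose X)"

text \<open>rho_ss = (1/(2 pi)) \<integral> Tr[G(j w)^H G(j w)] dw.\<close>
definition rho_ss :: "('n::finite \<Rightarrow> 'n \<Rightarrow> real) \<Rightarrow> real \<Rightarrow> real^'n \<Rightarrow> real" where
  "rho_ss a \<tau> \<sigma> = 1 / (2 * pi) *
     integral UNIV (\<lambda>\<omega>::real. Re (trace (conj_transpose (transfer a \<tau> \<sigma> (\<i> * \<omega>))
                                      ** transfer a \<tau> \<sigma> (\<i> * \<omega>))))"

text \<open>rho_ss as a function of the noise intensities sigma_i^2 (sigma_i = sqrt of it).\<close>
definition rho_ss_var :: "('n::finite \<Rightarrow> 'n \<Rightarrow> real) \<Rightarrow> real \<Rightarrow> real^'n \<Rightarrow> real" where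
  "rho_ss_var a \<tau> q = rho_ss a \<tau> (\<chi> k. sqrt (q $ k))"

end

theory Submission
  imports Defs "HOL-Complex_Analysis.Cauchy_Integral_Formula"
begin

text \<open>
  Diagonalise the Laplacian as \<open>L = P diag(d) P\<^sup>T\<close> with \<open>P\<close> orthogonal.  Connectedness makes the
  kernel of \<open>L\<close> the constant vectors, so \<open>M\<^sub>n\<close>, \<open>cos(\<tau>L)\<close>, \<open>sin(\<tau>L)\<close>, the pseudo-inverses and the
  resolvent in \<open>G\<close> are all functions of \<open>L\<close> in this basis.  Then \<open>\<rho>\<^sub>s\<^sub>s\<close> is linear in the intensities
  \<open>\<sigma>\<^sub>i\<^sup>2\<close>, with coefficients given by the scalar integrals of \<open>1 / |\<i>\<omega> + d e\<^sup>-\<^sup>\<i>\<^sup>\<tau>\<^sup>\<omega>|\<^sup>2\<close> over the nonzero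
  eigenvalues \<open>d\<close>.  Each integral equals \<open>\<pi> cos(\<tau>d) / (d (1 - sin(\<tau>d)))\<close>: up to an explicit multiple of
  \<open>1 / (\<omega>\<^sup>2 + d\<^sup>2)\<close>, the integrand is the real part of a function that is holomorphic in the closed
  right half-plane and decays quadratically, so its integral vanishes by Cauchy's theorem.
\<close>

section \<open>The scalar delay integral\<close>

text \<open>On an eigenvector of the Laplacian with eigenvalue \<open>l\<close>, the matrix inverted
  in the transfer function acts as multiplication by this scalar.\<close>

definition delay_char :: "real \<Rightarrow> real \<Rightarrow> complex \<Rightarrow> complex" where
  "delay_char l \<tau> s = s + of_real l * exp (- of_real \<tau> * s)"

text \<open>A zero with \<open>Re s >= 0\<close> satisfies
  \<open>|s| = l * exp (- tau * Re s) <= l\<close>, hence \<open>|tau * Im s| < pi / 2\<close>. Then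
  \<open>cos (tau * Im s) > 0\<close>, and the real part of \<open>s = - l * exp (- tau * s)\<close>
  is negative, a contradiction.\<close>

lemma delay_char_nonzero:
  assumes "l > 0" "\<tau> \<ge> 0" "\<tau> * l < pi / 2" "Re s \<ge> 0"
  shows "delay_char l \<tau> s \<noteq> 0"
proof
  assume "delay_char l \<tau> s = 0"
  then have eq: "s = - (of_real l * exp (- of_real \<tau> * s))"
    unfolding delay_char_def by (simp add: eq_neg_iff_add_eq_0)
  have "norm s = l * exp (- \<tau> * Re s)"
    by (subst eq) (use assms in \<open>simp add: norm_mult\<close>)
  also have "\<dots> \<le> l"
    using assms by (simp add: mult_left_le)
  finally have "\<bar>Im s\<bar> \<le> l"
    using abs_Im_le_cmod order_trans by blast
  then have "\<bar>\<tau> * Im s\<bar> \<le> \<tau> * l"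
    using assms by (simp add: abs_mult mult_left_mono)
  then have "cos (\<tau> * Im s) > 0"
    using assms by (intro cos_gt_zero_pi) auto
  moreover have "Re s = - (l * (exp (- \<tau> * Re s) * cos (\<tau> * Im s)))"
    by (subst eq) (simp add: Re_exp)
  ultimately have "Re s < 0"
    using assms by (metis exp_gt_zero mult_pos_pos neg_less_0_iff_less)
  with assms show False by simp
qed

lemma delay_char_imaginary_axis:
  "delay_char l \<tau> (\<i> * of_real w) =
     Complex (l * cos (\<tau> * w)) (w - l * sin (\<tau> * w))"
  by (simp add: delay_char_def complex_eq_iff Re_exp Im_exp)

lemma norm_delay_char_ge:
  assumes "l > 0" "\<tau> \<ge> 0" "Re s \<ge> 0"
  shows "norm (delay_char l \<tau> s) \<ge> norm s - l"
proof -
  have "norm (of_real l * exp (- of_real \<tau> * s)) = l * exp (- \<tau> * Re s)"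
    using assms by (simp add: norm_mult)
  also have "\<dots> \<le> l"
    using assms by (simp add: mult_left_le)
  finally show ?thesis
    unfolding delay_char_def using norm_diff_ineq[of s "of_real l * exp (- of_real \<tau> * s)"] by linarith
qed

lemma continuous_on_delay_char_imaginary_axis:
  "continuous_on S (\<lambda>w. delay_char l \<tau> (\<i> * of_real w))"
  unfolding delay_char_def by (intro continuous_intros)

text \<open>
  With \<open>F = delay_char l \<tau>\<close>, the function \<open>1 / (F(s) F(-s))\<close> equals \<open>H(s) + H(-s)\<close> for
  \<open>H(s) = (1/2 + c s / l - s / F(s)) / (s\<^sup>2 + l\<^sup>2)\<close>; this value of \<open>c\<close> makes the singularities
  at \<open>\<plusminus>\<i>l\<close> removable.  Subtracting \<open>(c / l) / (s + l)\<close> turns the decay of \<open>H\<close> into \<open>O(1/|s|\<^sup>2)\<close>.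
\<close>

definition delay_const :: "real \<Rightarrow> real \<Rightarrow> real" where
  "delay_const l \<tau> = cos (\<tau> * l) / (2 * (1 - sin (\<tau> * l)))"

text \<open>The numerator over \<open>s^2 + l^2\<close> of the corrected \<open>H\<close>, since
  \<open>c s / l - (c / l) (s^2 + l^2) / (s + l) = c (s - l) / (s + l)\<close>. In this form it is
  visibly bounded for large \<open>s\<close> in the right half-plane.\<close>

definition delay_num :: "real \<Rightarrow> real \<Rightarrow> complex \<Rightarrow> complex" where
  "delay_num l \<tau> s = 1/2 - s / delay_char l \<tau> s
     + of_real (delay_const l \<tau>) * ((s - of_real l) / (s + of_real l))"

lemma sin_less_one:
  fixes x :: real
  assumes "0 \<le> x" "x < pi / 2"
  shows "sin x < 1"
  using sin_monotone_2pi[of x "pi/2"] assms by simp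

text \<open>At \<open>s = e * i * l\<close> with a sign \<open>e\<close>, the last fraction is
  \<open>e * i\<close> and \<open>s / delay_char l tau s = 1/2 + e * i * delay_const l tau\<close>.
  The constant \<open>1/2\<close> cancels the real part, and \<open>delay_const\<close> is chosen to
  cancel the imaginary part.\<close>

lemma delay_num_zero:
  assumes "l > 0" "\<tau> \<ge> 0" "\<tau> * l < pi / 2" and s: "s = \<i> * of_real l \<or> s = - \<i> * of_real l"
  shows "delay_num l \<tau> s = 0"
proof -
  define C S where "C = cos (\<tau> * l)" and "S = sin (\<tau> * l)"
  have CS: "C\<^sup>2 + S\<^sup>2 = 1" "S < 1"
    using sin_less_one[of "\<tau> * l"] assms by (auto simp: C_def S_def)
  \<comment> \<open>The sign \<open>e\<close> lets one computation serve both points.\<close>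
  obtain e :: real where e: "e = 1 \<or> e = -1" and se: "s = \<i> * of_real (e * l)"
    using s by (metis mult.commute mult_1 mult_minus_left mult_minus_right of_real_minus)
  have e2: "e * e = 1" using e by auto
  have F: "delay_char l \<tau> s = of_real l * Complex C (e * (1 - S))"
    unfolding se delay_char_imaginary_axis C_def S_def using e
    by (auto simp: complex_eq_iff algebra_simps)
  \<comment> \<open>The squared modulus \<open>C^2 + (1 - S)^2\<close> collapses to
    \<open>2 * (1 - S)\<close>, which is the denominator of \<open>delay_const\<close>.\<close>
  have n2: "Complex C (e * (1 - S)) * Complex C (- e * (1 - S)) = of_real (2 * (1 - S))"
  proof -
    have "C * C + e * (1 - S) * (e * (1 - S)) = C^2 + (e*e) * (1 - S)^2"
      by (simp add: power2_eq_square algebra_simps)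
    also have "\<dots> = 2 * (1 - S)"
      using CS by (simp add: e2 power2_eq_square algebra_simps)
    finally show ?thesis by (simp add: complex_eq_iff algebra_simps)
  qed
  have 1: "s / delay_char l \<tau> s = \<i> * of_real e * Complex C (- e * (1 - S)) / of_real (2 * (1 - S))"
  proof -
    have "s / delay_char l \<tau> s = \<i> * of_real e / Complex C (e * (1 - S))"
      unfolding F using assms by (simp add: se)
    also have "\<dots> = \<i> * of_real e * Complex C (- e * (1 - S))
        / (Complex C (e * (1 - S)) * Complex C (- e * (1 - S)))"
    proof -
      have "Complex C (- e * (1 - S)) \<noteq> 0"
        using CS e by (auto simp: complex_eq_iff)
      then show ?thesis by (rule nonzero_mult_divide_mult_cancel_right[symmetric])
    qed
    finally show ?thesis unfolding n2 .
  qed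
  have 2: "(s - of_real l) / (s + of_real l) = \<i> * of_real e"
  proof -
    have "s + of_real l \<noteq> 0" using assms(1) by (auto simp: se complex_eq_iff)
    moreover have "s - of_real l = \<i> * of_real e * (s + of_real l)"
      using e2 by (simp add: se complex_eq_iff algebra_simps)
    ultimately show ?thesis by (simp add: divide_eq_eq)
  qed
  have "\<i> * of_real e * Complex C (- e * (1 - S)) = Complex (1 - S) (e * C)"
    using e2 by (simp add: complex_eq_iff algebra_simps)
  with 1 have 3: "s / delay_char l \<tau> s = Complex (1 - S) (e * C) / of_real (2 * (1 - S))" by simp
  have "Complex (1 - S) (e * C) / of_real (2 * (1 - S)) = Complex (1/2) (e * C / (2 * (1 - S)))"
    using CS by (simp add: complex_eq_iff Re_divide_of_real Im_divide_of_real del: of_real_mult of_real_diff)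
  then show ?thesis
    unfolding delay_num_def 2 3 delay_const_def C_def[symmetric] S_def[symmetric]
    by (simp add: complex_eq_iff)
qed

text \<open>With \<open>N\<close> the squared modulus of \<open>delay_char\<close> at
  \<open>i w\<close>, one has \<open>N - 2 * w * (w - l * S) = l^2 - w^2\<close>, so
  \<open>1 - 2 Re (s / delay_char l tau s)\<close> carries the factor \<open>l^2 - w^2\<close>; the
  remaining term carries it too. Since \<open>s^2 + l^2 = l^2 - w^2\<close> on the axis, division
  leaves the wanted integrand minus a multiple of \<open>1 / (w^2 + l^2)\<close>.\<close>

lemma Re_delay_num_imaginary_axis:
  assumes "l > 0" "\<tau> \<ge> 0" "\<tau> * l < pi / 2"
  shows "2 * Re (delay_num l \<tau> (\<i> * of_real w)) =
    (l\<^sup>2 - w\<^sup>2) * (1 / (norm (delay_char l \<tau> (\<i> * of_real w)))\<^sup>2 - 2 * delay_const l \<tau> / (w\<^sup>2 + l\<^sup>2))"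
proof -
  define C S where "C = cos (\<tau> * w)" and "S = sin (\<tau> * w)"
  have CS: "C\<^sup>2 + S\<^sup>2 = 1" by (auto simp: C_def S_def)
  define N where "N = (l * C)\<^sup>2 + (w - l * S)\<^sup>2"
  have F: "delay_char l \<tau> (\<i> * of_real w) = Complex (l * C) (w - l * S)"
    by (simp add: delay_char_imaginary_axis C_def S_def)
  have "Complex (l * C) (w - l * S) \<noteq> 0"
    using delay_char_nonzero[OF assms, of "\<i> * of_real w"] F by simp
  then have N: "N \<noteq> 0"
    by (auto simp: N_def complex_eq_iff sum_power2_eq_zero_iff)
  have nF: "(norm (delay_char l \<tau> (\<i> * of_real w)))\<^sup>2 = N"
    by (simp add: F N_def cmod_def)
  have 1: "Re (\<i> * of_real w / delay_char l \<tau> (\<i> * of_real w)) = w * (w - l * S) / N"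
    by (simp add: F N_def Re_divide)
  have 2: "Re ((\<i> * of_real w - of_real l) / (\<i> * of_real w + of_real l)) = (w\<^sup>2 - l\<^sup>2) / (w\<^sup>2 + l\<^sup>2)"
    by (simp add: Re_divide power2_eq_square algebra_simps)
  have Re_of_real_mult: "Re (of_real c * z) = c * Re z" for c z by simp
  have wl: "w\<^sup>2 + l\<^sup>2 \<noteq> 0" using assms(1) by (simp add: sum_power2_eq_zero_iff)
  have "N - 2 * (w * (w - l * S)) = l^2 * (C^2 + S^2) - w^2"
    by (simp add: N_def power2_eq_square algebra_simps)
  then have NN: "N - 2 * (w * (w - l * S)) = l^2 - w^2" using CS by simp
  have "1 - 2 * (w * (w - l * S) / N) = (N - 2 * (w * (w - l * S))) / N"
    using N by (simp add: field_simps)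
  then have 3: "1 - 2 * (w * (w - l * S) / N) = (l^2 - w^2) / N" using NN by simp
  have "Re (delay_num l \<tau> (\<i> * of_real w)) = 1/2 - w * (w - l * S) / N
     + delay_const l \<tau> * ((w\<^sup>2 - l\<^sup>2) / (w\<^sup>2 + l\<^sup>2))"
    unfolding delay_num_def plus_complex.sel minus_complex.sel Re_of_real_mult 1 2 by simp
  then have "2 * Re (delay_num l \<tau> (\<i> * of_real w)) = (1 - 2 * (w * (w - l * S) / N))
     + 2 * delay_const l \<tau> * ((w\<^sup>2 - l\<^sup>2) / (w\<^sup>2 + l\<^sup>2))" by simp
  also have "\<dots> = (l\<^sup>2 - w\<^sup>2) * (1 / N - 2 * delay_const l \<tau> / (w\<^sup>2 + l\<^sup>2))"
    unfolding 3 using wl N by (simp add: field_simps)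
  finally show ?thesis unfolding nF .
qed

text \<open>For \<open>|s| >= 2 l\<close> the denominator \<open>delay_char\<close> has modulus at
  least \<open>|s| / 2\<close>, and a point of the right half-plane is no farther from
  \<open>l\<close> than from \<open>-l\<close>. Dividing this bound by \<open>s^2 + l^2\<close>
  gives the quadratic decay needed on large arcs.\<close>

lemma norm_delay_num_le:
  assumes "l > 0" "\<tau> \<ge> 0" "\<tau> * l < pi / 2" "Re s \<ge> 0" "norm s \<ge> 2 * l"
  shows "norm (delay_num l \<tau> s) \<le> 5/2 + \<bar>delay_const l \<tau>\<bar>"
proof -
  have s0: "norm s > 0" using assms by linarith
  have "norm s / 2 \<le> norm (delay_char l \<tau> s)"
    using norm_delay_char_ge[of l \<tau> s] assms by linarith
  then have 1: "norm (s / delay_char l \<tau> s) \<le> 2"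
    using s0 by (simp add: norm_divide divide_le_eq)
  have "norm (s - of_real l) \<le> norm (s + of_real l)"
    unfolding cmod_def using assms
    by (intro real_sqrt_le_mono) (simp add: power2_eq_square algebra_simps)
  then have 2: "norm ((s - of_real l) / (s + of_real l)) \<le> 1"
    by (simp add: norm_divide divide_le_eq)
  have "norm (delay_num l \<tau> s) \<le> norm (1/2 :: complex) + norm (s / delay_char l \<tau> s)
      + \<bar>delay_const l \<tau>\<bar> * norm ((s - of_real l) / (s + of_real l))"
    unfolding delay_num_def
    by (metis (no_types, opaque_lifting) add_right_mono norm_mult norm_of_real norm_triangle_ineq norm_triangle_ineq4 order_trans)
  also have "\<dots> \<le> 1/2 + 2 + \<bar>delay_const l \<tau>\<bar> * 1"
    using 1 2 by (intro add_mono mult_left_mono) (auto simp: norm_divide)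
  finally show ?thesis by simp
qed

section \<open>Cauchy's theorem on half-discs and the removable singularities\<close>

text \<open>A primitive on the half-plane gives the segment from \<open>-iR\<close> to
  \<open>iR\<close> and the right semicircle the same integral, and the semicircle has length
  \<open>pi R\<close>. The factor \<open>i\<close> from \<open>ds = i dw\<close> does not change the
  modulus.\<close>

lemma integral_imaginary_axis_bound:
  assumes h: "h holomorphic_on {s. Re s \<ge> 0}" and "R > 0" "B \<ge> 0"
    and le: "\<And>s. Re s \<ge> 0 \<Longrightarrow> norm s = R \<Longrightarrow> norm (h s) \<le> B"
  obtains I where "((\<lambda>w. h (\<i> * of_real w)) has_integral I) {-R..R}" "norm I \<le> B * R * pi"
proof -
  let ?S = "{s. Re s \<ge> 0}"
  have hi: "h field_differentiable at x" if "x \<in> interior ?S - {}" for x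
    using that h by (metis Diff_empty at_within_interior holomorphic_on_def interior_subset subsetD)
  \<comment> \<open>The closed half-plane is convex, so continuity up to the boundary and
    differentiability inside yield a primitive that is valid on the imaginary axis as well.\<close>
  obtain H where H: "\<And>x. x \<in> ?S \<Longrightarrow> (H has_field_derivative h x) (at x within ?S)"
    using holomorphic_convex_primitive[OF convex_halfspace_Re_ge finite.emptyI
        holomorphic_on_imp_continuous_on[OF h] hi] by blast
  let ?D = "H (\<i> * of_real R) - H (- \<i> * of_real R)"
  have "((\<lambda>w. \<i> * h (\<i> * of_real w)) has_integral
      (H \<circ> (\<lambda>w. \<i> * of_real w)) R - (H \<circ> (\<lambda>w. \<i> * of_real w)) (-R)) {-R..R}"
  proof (rule fundamental_theorem_of_calculus)
    fix w assume "w \<in> {-R..R}"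
    show "((H \<circ> (\<lambda>w. \<i> * of_real w)) has_vector_derivative \<i> * h (\<i> * of_real w)) (at w within {-R..R})"
    proof (rule field_vector_diff_chain_within)
      show "((\<lambda>w. \<i> * of_real w) has_vector_derivative \<i>) (at w within {-R..R})"
        by (auto intro!: derivative_eq_intros)
      show "(H has_field_derivative h (\<i> * of_real w)) (at (\<i> * of_real w) within (\<lambda>w. \<i> * of_real w) ` {-R..R})"
        by (rule has_field_derivative_subset[OF H]) auto
    qed
  qed (use assms in auto)
  then have "((\<lambda>w. \<i> * h (\<i> * of_real w)) has_integral ?D) {-R..R}"
    by simp
  from has_integral_mult_right[OF this, of "-\<i>"]
  have I: "((\<lambda>w. h (\<i> * of_real w)) has_integral (- \<i> * ?D)) {-R..R}"
    by (simp add: mult.assoc[symmetric])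
  let ?c = "part_circlepath 0 R (- pi/2) (pi/2)"
  have img: "path_image ?c \<subseteq> ?S"
    using \<open>R > 0\<close> by (auto simp: path_image_part_circlepath Re_exp intro!: mult_nonneg_nonneg cos_ge_zero)
  have "(h has_contour_integral (H (pathfinish ?c) - H (pathstart ?c))) ?c"
    by (rule contour_integral_primitive[OF H]) (use img in auto)
  moreover have "exp (\<i> * of_real (pi/2)) = \<i>" "exp (\<i> * of_real (-pi/2)) = -\<i>"
    by (simp_all add: complex_eq_iff Re_exp Im_exp)
  ultimately have "(h has_contour_integral ?D) ?c"
    by (simp add: mult.commute)
  then have "norm ?D \<le> B * R * (pi/2 - (-pi/2))"
  proof (rule has_contour_integral_bound_part_circlepath)
    fix x assume x: "x \<in> path_image ?c"
    then have "norm x = R"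
      using in_path_image_part_circlepath[OF x] \<open>R > 0\<close> by simp
    with x img show "norm (h x) \<le> B" by (intro le) auto
  qed (use assms in auto)
  then have "norm (- \<i> * ?D) \<le> B * R * pi"
    by (simp add: norm_mult)
  with I that show thesis by blast
qed

text \<open>The numerator vanishes at both zeros of \<open>s^2 + l^2\<close>, so the two linear
  factors can be divided out one after the other, the derivative supplying the missing value each
  time.\<close>

lemma delay_num_removable:
  assumes "l > 0" "\<tau> \<ge> 0" "\<tau> * l < pi / 2"
  obtains h where "h holomorphic_on {s. Re s \<ge> 0}"
    "\<And>s. s \<noteq> \<i> * of_real l \<Longrightarrow> s \<noteq> - \<i> * of_real l \<Longrightarrow> h s = delay_num l \<tau> s / (s\<^sup>2 + of_real (l\<^sup>2))"
proof -
  \<comment> \<open>The points \<open>i l\<close> and \<open>-i l\<close> lie on the boundary of the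
    half-plane, whereas \<open>pole_lemma\<close> needs interior points; hence the larger open set
    that avoids only the zeros of the two denominators.\<close>
  define W where "W = {s. delay_char l \<tau> s \<noteq> 0} \<inter> {s. s + of_real l \<noteq> 0}"
  have "open W"
    unfolding W_def delay_char_def by (intro open_Int open_Collect_neq continuous_intros)
  have sub: "{s. Re s \<ge> 0} \<subseteq> W"
    using delay_char_nonzero[OF assms] assms(1) by (auto simp: W_def complex_eq_iff)
  define a where "a = \<i> * of_real l"
  define b where "b = - \<i> * of_real l"
  have ab: "a \<in> interior W" "b \<in> interior W" "a \<noteq> b"
    using sub assms(1) \<open>open W\<close> by (auto simp: a_def b_def interior_open complex_eq_iff)
  have num: "delay_num l \<tau> a = 0" "delay_num l \<tau> b = 0"
    using delay_num_zero[OF assms] by (auto simp: a_def b_def)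
  define g where "g = (\<lambda>z. if z = a then deriv (delay_num l \<tau>) a
      else (delay_num l \<tau> z - delay_num l \<tau> a) / (z - a))"
  have "delay_num l \<tau> holomorphic_on W"
    unfolding delay_num_def[abs_def] W_def delay_char_def by (intro holomorphic_intros) auto
  then have g: "g holomorphic_on W"
    unfolding g_def by (rule pole_lemma) (rule ab)
  define h where "h = (\<lambda>z. if z = b then deriv g b else (g z - g b) / (z - b))"
  have "h holomorphic_on W"
    unfolding h_def by (rule pole_lemma[OF g]) (rule ab)
  moreover have "h s = delay_num l \<tau> s / (s\<^sup>2 + of_real (l\<^sup>2))" if "s \<noteq> a" "s \<noteq> b" for s
  proof -
    have "(s - a) * (s - b) = s\<^sup>2 + of_real (l\<^sup>2)"
      by (simp add: a_def b_def power2_eq_square algebra_simps)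
    \<comment> \<open>Because \<open>delay_num\<close> vanishes at \<open>a\<close> and
      \<open>b\<close>, also \<open>g b = 0\<close>, and the subtracted values drop out of both
      quotients.\<close>
    then show ?thesis
      using that ab num by (simp add: h_def g_def)
  qed
  ultimately show thesis
    using that sub holomorphic_on_subset unfolding a_def b_def by blast
qed

section \<open>Passage to the whole real line\<close>

lemma has_integral_inverse_square_symmetric:
  fixes l R :: real
  assumes "l > 0" "R \<ge> 0"
  shows "((\<lambda>w. 1 / (w\<^sup>2 + l\<^sup>2)) has_integral 2 * arctan (R / l) / l) {-R..R}"
proof -
  have "((\<lambda>w. 1 / (w\<^sup>2 + l\<^sup>2)) has_integral arctan (R / l) / l - arctan (-R / l) / l) {-R..R}"
  proof (rule fundamental_theorem_of_calculus)
    fix w assume "w \<in> {-R..R}"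
    have "w\<^sup>2 + l\<^sup>2 \<noteq> 0" using assms by (simp add: sum_power2_eq_zero_iff)
    moreover have "1 + (w / l)\<^sup>2 = (w\<^sup>2 + l\<^sup>2) / l\<^sup>2"
      using assms by (simp add: field_simps)
    ultimately have *: "inverse (1 + (w / l)\<^sup>2) * (1 / l) / l = 1 / (w\<^sup>2 + l\<^sup>2)"
      using assms by (simp add: power2_eq_square)
    have "((\<lambda>w. arctan (w / l) / l) has_real_derivative inverse (1 + (w / l)\<^sup>2) * (1 / l) / l)
        (at w within {-R..R})"
      using assms by (auto intro!: derivative_eq_intros)
    then have "((\<lambda>w. arctan (w / l) / l) has_real_derivative 1 / (w\<^sup>2 + l\<^sup>2)) (at w within {-R..R})"
      unfolding * .
    then show "((\<lambda>w. arctan (w / l) / l) has_vector_derivative 1 / (w\<^sup>2 + l\<^sup>2)) (at w within {-R..R})"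
      by (simp add: has_real_derivative_iff_has_vector_derivative)
  qed (use assms in auto)
  then show ?thesis by (simp add: arctan_minus)
qed

text \<open>Nonnegativity makes the truncations to \<open>[-n, n]\<close> increase, so monotone
  convergence upgrades a limit of symmetric integrals to an integral over the line.\<close>

lemma has_integral_UNIV_symmetric_limit:
  fixes f :: "real \<Rightarrow> real"
  assumes "\<And>w. f w \<ge> 0" and "\<And>n. (f has_integral J n) {- real n..real n}" and "J \<longlonglongrightarrow> I"
  shows "(f has_integral I) UNIV"
proof (rule has_integral_monotone_convergence_increasing)
  show "((\<lambda>w. if w \<in> {- real n..real n} then f w else 0) has_integral J n) UNIV" for n
    by (subst has_integral_restrict_UNIV) (rule assms)
  show "(if w \<in> {- real n..real n} then f w else 0) \<le> (if w \<in> {- real (Suc n)..real (Suc n)} then f w else 0)"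
    for n w using assms(1) by auto
  show "(\<lambda>n. if w \<in> {- real n..real n} then f w else 0) \<longlonglongrightarrow> f w" for w
  proof (rule tendsto_eventually)
    show "\<forall>\<^sub>F n in sequentially. (if w \<in> {- real n..real n} then f w else 0) = f w"
      using eventually_ge_at_top[of "nat \<lceil>\<bar>w\<bar>\<rceil>"]
      by eventually_elim (auto simp: nat_le_iff ceiling_le_iff abs_le_iff)
  qed
qed (fact assms)

text \<open>On \<open>[-R, R]\<close> the integrand is \<open>2 Re h\<close> plus
  \<open>2 c / (w^2 + l^2)\<close> away from the removable points. The first part integrates to
  \<open>O(1/R)\<close> by the half-disc estimate, the second to
  \<open>4 c arctan (R / l) / l\<close>, whose limit is the claimed value.\<close>

theorem has_integral_inverse_delay_char:
  assumes "l > 0" "\<tau> \<ge> 0" "\<tau> * l < pi / 2"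
  shows "((\<lambda>w. 1 / (norm (delay_char l \<tau> (\<i> * of_real w)))\<^sup>2) has_integral
           pi * cos (\<tau> * l) / (l * (1 - sin (\<tau> * l)))) UNIV"
proof -
  let ?f = "\<lambda>w. 1 / (norm (delay_char l \<tau> (\<i> * of_real w)))\<^sup>2"
  define c where "c = delay_const l \<tau>"
  obtain h where h: "h holomorphic_on {s. Re s \<ge> 0}"
    and heq: "\<And>s. s \<noteq> \<i> * of_real l \<Longrightarrow> s \<noteq> - \<i> * of_real l \<Longrightarrow> h s = delay_num l \<tau> s / (s\<^sup>2 + of_real (l\<^sup>2))"
    using delay_num_removable[OF assms] by blast
  define K where "K = 5/2 + \<bar>c\<bar>"
  have bound: "norm (h s) \<le> 2 * K / (norm s)\<^sup>2" if "Re s \<ge> 0" "norm s \<ge> 2 * l" for s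
  proof -
    have s0: "norm s > l" "norm s > 0" using that assms by linarith+
    then have "s \<noteq> \<i> * of_real l" "s \<noteq> - \<i> * of_real l"
      using assms by (auto simp: norm_mult)
    note hs = heq[OF this]
    \<comment> \<open>From \<open>l <= |s| / 2\<close> one gets
      \<open>|s^2 + l^2| >= 3/4 |s|^2\<close>; the weaker factor \<open>1/2\<close> is
      enough.\<close>
    have "(2 * l)\<^sup>2 \<le> (norm s)\<^sup>2" using that assms by (intro power_mono) auto
    then have "l\<^sup>2 \<le> (norm s)\<^sup>2 / 4" by (simp add: power_mult_distrib)
    moreover have "norm (s\<^sup>2 + of_real (l\<^sup>2)) \<ge> norm (s\<^sup>2) - norm (of_real (l\<^sup>2) :: complex)"
      by (rule norm_diff_ineq)
    ultimately have *: "norm (s\<^sup>2 + of_real (l\<^sup>2)) \<ge> (norm s)\<^sup>2 / 2"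
      by (simp add: norm_power del: of_real_power) (smt (verit) field_sum_of_halves zero_le_power2)
    have "norm (h s) = norm (delay_num l \<tau> s) / norm (s\<^sup>2 + of_real (l\<^sup>2))"
      by (simp add: hs norm_divide del: of_real_power)
    also have "\<dots> \<le> K / ((norm s)\<^sup>2 / 2)"
      using norm_delay_num_le[OF assms that] * s0 by (intro frac_le) (auto simp: K_def c_def)
    finally show ?thesis by (simp add: field_simps)
  qed
  have K: "K \<ge> 0" by (simp add: K_def)
  have ev: "\<exists>J. (?f has_integral J) {-R..R} \<and> \<bar>J - 4 * c * arctan (R / l) / l\<bar> \<le> 4 * K * pi / R"
    if R: "R \<ge> 2 * l" for R
  proof -
    have R0: "R > 0" using R assms by linarith
    obtain I where I: "((\<lambda>w. h (\<i> * of_real w)) has_integral I) {-R..R}"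
      and nI: "norm I \<le> (2 * K / R\<^sup>2) * R * pi"
    proof (rule integral_imaginary_axis_bound[OF h R0, of "2 * K / R\<^sup>2"])
      show "norm (h s) \<le> 2 * K / R\<^sup>2" if "Re s \<ge> 0" "norm s = R" for s
        using bound[of s] that R by auto
    qed (use K in auto)
    have "((\<lambda>w. 2 * Re (h (\<i> * of_real w))) has_integral 2 * Re I) {-R..R}"
      using has_integral_mult_right[OF has_integral_Re[OF I], of 2] by simp
    then have "((\<lambda>w. ?f w - 2 * c / (w\<^sup>2 + l\<^sup>2)) has_integral 2 * Re I) {-R..R}"
    \<comment> \<open>At \<open>w = l\<close> and \<open>w = -l\<close> the function
      \<open>h\<close> is not given by the quotient, so these two points are excepted.\<close>
    proof (rule has_integral_spike_finite[rotated 2])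
      show "finite {l, -l}" by simp
      fix w assume w: "w \<in> {-R..R} - {l, -l}"
      have ne: "\<i> * of_real w \<noteq> \<i> * of_real l" "\<i> * of_real w \<noteq> - \<i> * of_real l"
        using w by (auto simp: complex_eq_iff)
      have wl: "l\<^sup>2 - w\<^sup>2 \<noteq> 0" using w by (auto simp: power2_eq_iff)
      have "(\<i> * complex_of_real w)\<^sup>2 + of_real (l\<^sup>2) = of_real (l\<^sup>2 - w\<^sup>2)"
        by (simp add: power_mult_distrib)
      then have "2 * Re (h (\<i> * of_real w)) = 2 * Re (delay_num l \<tau> (\<i> * of_real w)) / (l\<^sup>2 - w\<^sup>2)"
        using heq[OF ne] by (simp del: of_real_power of_real_diff add: Re_divide_of_real)
      also have "\<dots> = ?f w - 2 * c / (w\<^sup>2 + l\<^sup>2)"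
        unfolding Re_delay_num_imaginary_axis[OF assms] c_def using wl by simp
      finally show "?f w - 2 * c / (w\<^sup>2 + l\<^sup>2) = 2 * Re (h (\<i> * of_real w))" by simp
    qed
    moreover have "((\<lambda>w. 2 * c * (1 / (w\<^sup>2 + l\<^sup>2))) has_integral 2 * c * (2 * arctan (R / l) / l)) {-R..R}"
      using assms R0 by (intro has_integral_mult_right has_integral_inverse_square_symmetric) auto
    ultimately have "((\<lambda>w. (?f w - 2 * c / (w\<^sup>2 + l\<^sup>2)) + 2 * c * (1 / (w\<^sup>2 + l\<^sup>2))) has_integral
        2 * Re I + 2 * c * (2 * arctan (R / l) / l)) {-R..R}"
      by (rule has_integral_add)
    then have "(?f has_integral 2 * Re I + 4 * c * arctan (R / l) / l) {-R..R}"
      by (simp add: mult.assoc)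
    moreover have "\<bar>2 * Re I\<bar> \<le> 4 * K * pi / R"
      using nI abs_Re_le_cmod[of I] R0 by (simp add: power2_eq_square)
    ultimately show ?thesis
      by (intro exI[of _ "2 * Re I + 4 * c * arctan (R / l) / l"]) auto
  qed
  define J where "J = (\<lambda>n. integral {- real n..real n} ?f)"
  have J: "(?f has_integral J n) {- real n..real n}" for n
    unfolding J_def
  proof (intro integrable_integral integrable_continuous_real continuous_intros
      continuous_on_delay_char_imaginary_axis)
  qed (use delay_char_nonzero[OF assms] in auto)
  have lim: "(\<lambda>n. 4 * c * arctan (real n / l) / l) \<longlonglongrightarrow> 4 * c * (pi / 2) / l"
  proof -
    have "filterlim (\<lambda>n. inverse l * real n) at_top sequentially"
      using assms(1) filterlim_real_sequentially
      by (intro filterlim_tendsto_pos_mult_at_top[OF tendsto_const]) auto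
    then have "filterlim (\<lambda>n. real n / l) at_top sequentially"
      by (simp only: divide_inverse mult.commute)
    then have "(\<lambda>n. arctan (real n / l)) \<longlonglongrightarrow> pi / 2"
      using tendsto_arctan_at_top filterlim_compose by blast
    then show ?thesis
      using assms(1) by (intro tendsto_intros) auto
  qed
  have "(\<lambda>n. J n - 4 * c * arctan (real n / l) / l) \<longlonglongrightarrow> 0"
  proof (rule Lim_null_comparison)
    show "(\<lambda>n. 4 * K * pi / real n) \<longlonglongrightarrow> 0"
      by (rule lim_const_over_n)
    show "\<forall>\<^sub>F n in sequentially. norm (J n - 4 * c * arctan (real n / l) / l) \<le> 4 * K * pi / real n"
      using eventually_ge_at_top[of "nat \<lceil>2 * l\<rceil>"]
    proof eventually_elim
      case (elim n)
      then have "real n \<ge> 2 * l" by linarith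
      then obtain J' where "(?f has_integral J') {- real n..real n}"
        and J': "\<bar>J' - 4 * c * arctan (real n / l) / l\<bar> \<le> 4 * K * pi / real n"
        using ev by blast
      \<comment> \<open>Uniqueness of the integral transfers the error bound, known only for
        \<open>n >= 2 l\<close>, to the sequence \<open>J\<close> defined for all
        \<open>n\<close>.\<close>
      then have "J' = J n" using J has_integral_unique by blast
      with J' show ?case by simp
    qed
  qed
  from tendsto_add[OF this lim] have "J \<longlonglongrightarrow> 4 * c * (pi / 2) / l" by simp
  then have "(?f has_integral 4 * c * (pi / 2) / l) UNIV"
    by (intro has_integral_UNIV_symmetric_limit[OF _ J]) auto
  moreover have "4 * c * (pi / 2) / l = pi * cos (\<tau> * l) / (l * (1 - sin (\<tau> * l)))"
    using sin_less_one[of "\<tau> * l"] assms by (simp add: c_def delay_const_def field_simps)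
  ultimately show ?thesis by simp
qed

section \<open>Spectral decomposition of symmetric matrices\<close>

lemma inner_symmetric_matrix:
  fixes A :: "real^'n^'n"
  assumes "transpose A = A"
  shows "x \<bullet> (A *v y) = (A *v x) \<bullet> y"
  by (metis assms dot_lmul_matrix vector_transpose_matrix)

text \<open>A maximiser of the Rayleigh quotient on the invariant subspace is an eigenvector.\<close>
lemma symmetric_matrix_eigenvector_in_subspace:
  fixes A :: "real^'n^'n"
  assumes sym: "transpose A = A" and S: "subspace S" "S \<noteq> {0}"
    and inv: "\<And>x. x \<in> S \<Longrightarrow> A *v x \<in> S"
  obtains v m where "v \<in> S" "norm v = 1" "A *v v = m *\<^sub>R v"
proof -
  let ?K = "S \<inter> sphere 0 1"
  let ?q = "\<lambda>x. x \<bullet> (A *v x)"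
  obtain x where "x \<in> S" "x \<noteq> 0"
    using S subspace_0 by blast
  then have "(1 / norm x) *\<^sub>R x \<in> ?K"
    using S by (simp add: subspace_scale)
  moreover have "compact ?K"
    using S by (simp add: closed_Int_compact closed_subspace)
  moreover have "continuous_on ?K ?q"
    by (intro continuous_intros linear_continuous_on linear_linear[THEN iffD1] matrix_vector_mul_linear)
  ultimately obtain v where v: "v \<in> ?K" and max: "\<And>y. y \<in> ?K \<Longrightarrow> ?q y \<le> ?q v"
    using continuous_attains_sup[of ?K ?q] by blast
  define m where "m = ?q v"
  have le: "?q x \<le> m * (x \<bullet> x)" if "x \<in> S" for x
  proof (cases "x = 0")
    case False
    then have "(1 / norm x) *\<^sub>R x \<in> ?K"
      using that S by (simp add: subspace_scale)
    then have "?q ((1 / norm x) *\<^sub>R x) \<le> m"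
      using max m_def by blast
    then have "?q x / (norm x)\<^sup>2 \<le> m"
      by (simp add: matrix_vector_mult_scaleR power2_eq_square)
    then show ?thesis
      using False by (simp add: divide_le_eq power2_norm_eq_inner)
  qed simp
  define w where "w = m *\<^sub>R v - A *v v"
  have wS: "w \<in> S" and vS: "v \<in> S" and nv: "norm v = 1"
    using v inv S by (auto simp: w_def subspace_diff subspace_scale)
  define b where "b = w \<bullet> w"
  define k where "k = m * (w \<bullet> w) - ?q w"
  have k: "k \<ge> 0" using le[OF wS] by (simp add: k_def)
  have vv: "v \<bullet> v = 1" using nv by (simp add: norm_eq_1)
  \<comment> \<open>Perturbing the maximiser \<open>v\<close> along the residual \<open>w\<close>:
    the gap \<open>m |x|^2 - ?q x\<close> is nonnegative on \<open>S\<close> and vanishes at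
    \<open>v\<close>, and its linear coefficient in \<open>t\<close> is \<open>2 (w . w)\<close>.
    Nonnegativity for every \<open>t\<close> therefore forces \<open>w = 0\<close>.\<close>
  have quad: "0 \<le> 2 * t * b + t\<^sup>2 * k" for t
  proof -
    have "v + t *\<^sub>R w \<in> S" using vS wS S by (simp add: subspace_add subspace_scale)
    from le[OF this]
    have "0 \<le> m * ((v + t *\<^sub>R w) \<bullet> (v + t *\<^sub>R w)) - ?q (v + t *\<^sub>R w)" by simp
    also have "\<dots> = (m * (v \<bullet> v) - ?q v) + 2 * t * (w \<bullet> (m *\<^sub>R v - A *v v)) + t\<^sup>2 * k"
      using inner_symmetric_matrix[OF sym, of v w]
      by (simp add: k_def algebra_simps matrix_vector_mult_scaleR inner_commute
          matrix_vector_right_distrib power2_eq_square)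
    also have "\<dots> = 2 * t * b + t\<^sup>2 * k"
      unfolding w_def[symmetric] b_def by (simp add: m_def vv)
    finally show ?thesis .
  qed
  have "b = 0"
  proof (rule ccontr)
    assume "b \<noteq> 0"
    then have b: "b > 0" by (simp add: b_def)
    \<comment> \<open>A negative \<open>t\<close> small enough for the linear term to dominate;
      \<open>k + 1\<close> replaces \<open>k\<close> so that \<open>k = 0\<close> causes no division
      by zero.\<close>
    define t where "t = - b / (k + 1)"
    have "t * (k + 1) = - b" using k by (simp add: t_def)
    then have tk: "t * k = - b - t" by (simp add: algebra_simps)
    have "2 * t * b + t\<^sup>2 * k = t * (2 * b + t * k)"
      by (simp add: algebra_simps power2_eq_square)
    also have "\<dots> = t * (b - t)" unfolding tk by simp
    also have "\<dots> < 0"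
    proof -
      have "t < 0" using b k by (simp add: t_def divide_neg_pos)
      then show ?thesis using b by (simp add: mult_neg_pos)
    qed
    finally show False using quad[of t] by simp
  qed
  then have "A *v v = m *\<^sub>R v" by (simp add: b_def w_def)
  with that vS nv show thesis by blast
qed

text \<open>Induction on the dimension: split off one unit eigenvector \<open>v\<close>. By symmetry
  of \<open>A\<close>, the orthogonal complement of \<open>v\<close> inside \<open>S\<close> is
  again invariant, and its dimension is one less.\<close>

lemma symmetric_matrix_orthonormal_eigenvectors:
  fixes A :: "real^'n^'n"
  assumes sym: "transpose A = A" and S: "subspace S"
    and inv: "\<And>x. x \<in> S \<Longrightarrow> A *v x \<in> S"
  shows "\<exists>B. finite B \<and> card B = dim S \<and> B \<subseteq> S \<and> pairwise orthogonal B \<and>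
     (\<forall>v\<in>B. norm v = 1 \<and> (\<exists>m. A *v v = m *\<^sub>R v))"
  using S inv
proof (induction "dim S" arbitrary: S)
  case 0
  then show ?case by (intro exI[of _ "{}"]) auto
next
  case (Suc n)
  then have "S \<noteq> {0}" by (metis dim_singleton nat.distinct(1))
  then obtain v m where v: "v \<in> S" "norm v = 1" "A *v v = m *\<^sub>R v"
    using symmetric_matrix_eigenvector_in_subspace[OF sym Suc.prems(1) _ Suc.prems(2)] by blast
  define T where "T = {y \<in> S. \<forall>x \<in> span {v}. orthogonal x y}"
  have T: "y \<in> T \<longleftrightarrow> y \<in> S \<and> orthogonal v y" for y
    by (auto simp: T_def span_singleton orthogonal_def)
  have "dim T + dim (span {v}) = dim S"
    unfolding T_def using v Suc.prems
    by (intro dim_subspace_orthogonal_to_vectors) (auto simp: span_minimal)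
  moreover have "v \<noteq> 0" using v by auto
  ultimately have dT: "n = dim T" using Suc.hyps(2) by (simp add: dim_singleton)
  have "subspace T"
    using Suc.prems(1) by (auto simp: subspace_def T orthogonal_clauses)
  moreover have "A *v x \<in> T" if "x \<in> T" for x
    using that Suc.prems(2) inner_symmetric_matrix[OF sym, of v x] v
    by (simp add: T orthogonal_def)
  ultimately obtain B where B: "finite B" "card B = dim T" "B \<subseteq> T" "pairwise orthogonal B"
     "\<forall>v\<in>B. norm v = 1 \<and> (\<exists>m. A *v v = m *\<^sub>R v)"
    using Suc.hyps(1)[OF dT] by blast
  have "v \<notin> B" using B(3) v by (auto simp: T orthogonal_def norm_eq_1)
  then show ?case
    using B v dT Suc.hyps(2)
    by (intro exI[of _ "insert v B"])
       (auto simp: T pairwise_insert orthogonal_commute)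
qed

section \<open>Functions of a matrix in a fixed orthonormal eigenbasis\<close>

lemma diagm_nth: "diagm f $ i $ j = (if i = j then f i else 0)"
  by (simp add: diagm_def)

lemma matrix_mult_diagm_nth:
  fixes A :: "'a::semiring_1^'n::finite^'m::finite"
  shows "(A ** diagm f) $ i $ j = A $ i $ j * f j"
  by (simp add: matrix_matrix_mult_def diagm_nth if_distrib[of "\<lambda>x. _ * x"] cong: if_cong)

text \<open>A functional calculus: for orthogonal \<open>P\<close>, sums, products and power series
  act on the eigenvalues \<open>f\<close> alone. The scalar ring is left general so that the
  complexified basis \<open>cmat P\<close> is covered; its entries are real, so the plain transpose
  is the right one there too.\<close>

definition spectral :: "'a::comm_ring_1^'n::finite^'n \<Rightarrow> ('n \<Rightarrow> 'a) \<Rightarrow> 'a^'n^'n" where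
  "spectral P f = P ** diagm f ** transpose P"

theorem symmetric_matrix_spectral:
  fixes A :: "real^'n^'n"
  assumes sym: "transpose A = A"
  obtains P d where "orthogonal_matrix P" "A = spectral P d"
proof -
  obtain B :: "(real^'n) set" where B: "finite B" "card B = CARD('n)" "pairwise orthogonal B"
     "\<forall>v\<in>B. norm v = 1 \<and> (\<exists>m. A *v v = m *\<^sub>R v)"
    using symmetric_matrix_orthonormal_eigenvectors[OF sym subspace_UNIV] by auto
  \<comment> \<open>There are exactly \<open>CARD('n)\<close> eigenvectors, so they can be indexed
    by the type itself and become the columns of a square matrix.\<close>
  obtain e where e: "bij_betw e (UNIV :: 'n set) B"
    using B finite_same_card_bij[of "UNIV :: 'n set" B] by auto
  have eB: "e k \<in> B" for k using e by (auto simp: bij_betw_def)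
  define P :: "real^'n^'n" where "P = (\<chi> i k. e k $ i)"
  have col: "column k P = e k" for k by (simp add: column_def P_def)
  have "inj e" using e by (simp add: bij_betw_def)
  then have "orthogonal (e i) (e j)" if "i \<noteq> j" for i j
    using that eB by (intro pairwiseD[OF B(3)]) (auto dest: injD)
  then have P: "orthogonal_matrix P"
    using B(4) eB by (auto simp: orthogonal_matrix_orthonormal_columns col)
  have "\<forall>k. \<exists>m. A *v e k = m *\<^sub>R e k" using B(4) eB by blast
  then obtain d where d: "\<And>k. A *v e k = d k *\<^sub>R e k" by metis
  have "A ** P = P ** diagm d"
  proof -
    have "(A ** P) $ i $ k = (P ** diagm d) $ i $ k" for i k
    proof -
      have "(A ** P) $ i $ k = (A *v e k) $ i"
        by (simp add: matrix_matrix_mult_def matrix_vector_mult_def P_def)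
      then show ?thesis by (simp add: d matrix_mult_diagm_nth P_def)
    qed
    then show ?thesis by (simp add: vec_eq_iff)
  qed
  then have "A ** (P ** transpose P) = spectral P d"
    by (simp add: spectral_def matrix_mul_assoc)
  then have "A = spectral P d"
    using P by (simp add: orthogonal_matrix_def)
  with P that show thesis by blast
qed

lemma spectral_nth:
  "spectral P f $ i $ j = (\<Sum>k\<in>UNIV. P $ i $ k * f k * P $ j $ k)"
  unfolding spectral_def by (subst matrix_matrix_mult_def) (simp add: matrix_mult_diagm_nth transpose_def)

lemma spectral_mult:
  assumes "orthogonal_matrix P"
  shows "spectral P f ** spectral P g = spectral P (\<lambda>k. f k * g k)"
proof -
  have "spectral P f ** spectral P g = P ** diagm f ** (transpose P ** P) ** diagm g ** transpose P"
    by (simp add: spectral_def matrix_mul_assoc)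
  also have "\<dots> = P ** (diagm f ** diagm g) ** transpose P"
    using assms by (simp add: orthogonal_matrix_def matrix_mul_assoc)
  also have "diagm f ** diagm g = diagm (\<lambda>k. f k * g k)"
    by (auto simp: vec_eq_iff matrix_mult_diagm_nth diagm_nth)
  finally show ?thesis by (simp add: spectral_def)
qed

lemma spectral_const:
  assumes "orthogonal_matrix P"
  shows "spectral P (\<lambda>k. c) = mat c"
proof -
  have "spectral P (\<lambda>k. c) $ i $ j = mat c $ i $ j" for i j
  proof -
    have "spectral P (\<lambda>k. c) $ i $ j = c * (\<Sum>k\<in>UNIV. P $ i $ k * P $ j $ k)"
      by (simp add: spectral_nth sum_distrib_left ac_simps)
    also have "(\<Sum>k\<in>UNIV. P $ i $ k * P $ j $ k) = (P ** transpose P) $ i $ j"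
      by (simp add: matrix_matrix_mult_def transpose_def)
    also have "\<dots> = mat 1 $ i $ j"
      using assms by (simp add: orthogonal_matrix_def)
    finally show ?thesis by (simp add: mat_def)
  qed
  then show ?thesis by (simp add: vec_eq_iff)
qed

lemma spectral_add: "spectral P f + spectral P g = spectral P (\<lambda>k. f k + g k)"
  by (simp add: vec_eq_iff spectral_nth algebra_simps sum.distrib)

lemma spectral_diff: "spectral P f - spectral P g = spectral P (\<lambda>k. f k - g k)"
  by (simp add: vec_eq_iff spectral_nth algebra_simps sum_subtractf)

lemma spectral_scaleR: "c *\<^sub>R spectral P f = spectral P (\<lambda>k. c * f k)"
  by (simp add: vec_eq_iff spectral_nth sum_distrib_left ac_simps)

lemma transpose_spectral [simp]: "transpose (spectral P f) = spectral P f"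
  by (simp add: vec_eq_iff spectral_nth transpose_def ac_simps)

lemma mpow_spectral:
  assumes "orthogonal_matrix P"
  shows "mpow (spectral P f) m = spectral P (\<lambda>k. f k ^ m)"
  by (induction m) (simp_all add: assms spectral_const spectral_mult)

text \<open>A power series in the matrix converges entrywise because it does so at each eigenvalue.
  The exponent \<open>p m\<close> is arbitrary so as to cover the even powers of the cosine and the
  odd ones of the sine.\<close>

lemma spectral_sums:
  fixes P :: "real^'n::finite^'n"
  assumes "\<And>k. (\<lambda>m. c m * f k ^ p m) sums g k" and "orthogonal_matrix P"
  shows "(\<lambda>m. c m * mpow (spectral P f) (p m) $ i $ j) sums spectral P g $ i $ j"
proof -
  have "(\<lambda>m. \<Sum>k\<in>UNIV. P $ i $ k * (c m * f k ^ p m) * P $ j $ k) sums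
      (\<Sum>k\<in>UNIV. P $ i $ k * g k * P $ j $ k)"
    using assms by (intro sums_sum sums_mult sums_mult2) auto
  then show ?thesis
    by (simp add: mpow_spectral[OF assms(2)] spectral_nth sum_distrib_left ac_simps)
qed

lemma mcos_spectral:
  assumes "orthogonal_matrix P"
  shows "mcos (spectral P f) = spectral P (\<lambda>k. cos (f k))"
  unfolding mcos_def vec_eq_iff
  using sums_unique[OF spectral_sums[OF cos_paired assms]] by simp

lemma msin_spectral:
  assumes "orthogonal_matrix P"
  shows "msin (spectral P f) = spectral P (\<lambda>k. sin (f k))"
  unfolding msin_def vec_eq_iff
  using sums_unique[OF spectral_sums[OF sin_paired assms]] by simp

section \<open>Pseudo-inverses and inverses in the eigenbasis\<close>

text \<open>Transposing \<open>X ** Z ** X ** Y\<close> swaps the two symmetric factors, which gives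
  \<open>X ** Y = X ** Z\<close>; in the same way \<open>Y ** X = Z ** X\<close>. Then
  \<open>Y = Y ** X ** Y = Z ** X ** Z = Z\<close>.\<close>

lemma penrose_unique:
  fixes X Y Z :: "real^'n::finite^'n"
  assumes "X ** Y ** X = X" "Y ** X ** Y = Y" "transpose (X ** Y) = X ** Y" "transpose (Y ** X) = Y ** X"
    and "X ** Z ** X = X" "Z ** X ** Z = Z" "transpose (X ** Z) = X ** Z" "transpose (Z ** X) = Z ** X"
  shows "Y = Z"
proof -
  have "X ** Y = transpose (X ** Z ** X ** Y)" using assms by simp
  also have "\<dots> = transpose (X ** Y) ** transpose (X ** Z)"
    by (simp add: matrix_transpose_mul[symmetric] matrix_mul_assoc)
  also have "\<dots> = X ** Y ** X ** Z" using assms by (simp add: matrix_mul_assoc)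
  also have "\<dots> = X ** Z" using assms by simp
  finally have XY: "X ** Y = X ** Z" .
  have "Y ** X = transpose (Y ** X ** Z ** X)"
    using assms by (metis matrix_mul_assoc)
  also have "\<dots> = transpose (Z ** X) ** transpose (Y ** X)"
    by (simp add: matrix_transpose_mul[symmetric] matrix_mul_assoc)
  also have "\<dots> = Z ** (X ** Y ** X)" by (simp only: assms(4,8) matrix_mul_assoc)
  also have "\<dots> = Z ** X" by (simp only: assms(1))
  finally have YX: "Y ** X = Z ** X" .
  have "Y = Y ** X ** Y" using assms by simp
  also have "\<dots> = Z ** (X ** Y)" by (simp add: YX matrix_mul_assoc)
  also have "\<dots> = Z" using assms by (simp add: XY matrix_mul_assoc)
  finally show ?thesis .
qed

text \<open>The convention \<open>inverse 0 = 0\<close> is exactly what the Penrose equations demand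
  on the kernel, so zero eigenvalues need no separate case.\<close>

lemma pinv_spectral:
  assumes P: "orthogonal_matrix P"
  shows "pinv (spectral P f) = spectral P (\<lambda>k. inverse (f k))"
  unfolding pinv_def
proof (rule the_equality)
  have inv: "(\<lambda>k. f k * inverse (f k) * f k) = f"
    "(\<lambda>k. inverse (f k) * f k * inverse (f k)) = (\<lambda>k. inverse (f k))"
    by (auto simp: fun_eq_iff field_simps)
  show *: "spectral P f ** spectral P (\<lambda>k. inverse (f k)) ** spectral P f = spectral P f \<and>
    spectral P (\<lambda>k. inverse (f k)) ** spectral P f ** spectral P (\<lambda>k. inverse (f k)) =
      spectral P (\<lambda>k. inverse (f k)) \<and>
    transpose (spectral P f ** spectral P (\<lambda>k. inverse (f k))) = spectral P f ** spectral P (\<lambda>k. inverse (f k)) \<and>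
    transpose (spectral P (\<lambda>k. inverse (f k)) ** spectral P f) = spectral P (\<lambda>k. inverse (f k)) ** spectral P f"
    by (simp add: spectral_mult[OF P] inv)
  show "Y = spectral P (\<lambda>k. inverse (f k))"
    if "spectral P f ** Y ** spectral P f = spectral P f \<and>
         Y ** spectral P f ** Y = Y \<and>
         transpose (spectral P f ** Y) = spectral P f ** Y \<and> transpose (Y ** spectral P f) = Y ** spectral P f" for Y
    using that * by (elim conjE) (rule penrose_unique[of "spectral P f"])
qed

lemma matrix_inv_eqI:
  fixes A B :: "'a::semiring_1^'n::finite^'n"
  assumes "A ** B = mat 1" "B ** A = mat 1"
  shows "matrix_inv A = B"
proof -
  have "A ** matrix_inv A = mat 1 \<and> matrix_inv A ** A = mat 1"
    unfolding matrix_inv_def by (rule someI[of _ B]) (use assms in auto)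
  then show ?thesis
    by (metis assms(2) matrix_mul_assoc matrix_mul_lid matrix_mul_rid)
qed

lemma matrix_inv_spectral:
  fixes P :: "'a::field^'n::finite^'n"
  assumes "orthogonal_matrix P" "\<And>k. f k \<noteq> 0"
  shows "matrix_inv (spectral P f) = spectral P (\<lambda>k. inverse (f k))"
  by (rule matrix_inv_eqI) (simp_all add: assms spectral_mult spectral_const)

lemma cmat_mult: "cmat (A ** B) = cmat A ** cmat B"
  by (simp add: cmat_def vec_eq_iff matrix_matrix_mult_def)

lemma orthogonal_matrix_cmat:
  assumes "orthogonal_matrix P" shows "orthogonal_matrix (cmat P)"
proof -
  have "transpose (cmat P) = cmat (transpose P)" "cmat (mat 1) = mat 1"
    by (simp_all add: cmat_def vec_eq_iff transpose_def mat_def)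
  then show ?thesis
    using assms by (simp add: orthogonal_matrix_def cmat_mult[symmetric])
qed

lemma cmat_spectral: "cmat (spectral P f) = spectral (cmat P) (\<lambda>k. of_real (f k))"
  by (simp add: vec_eq_iff spectral_nth cmat_def)

lemma spectral_column:
  fixes P :: "real^'n::finite^'n"
  assumes P: "orthogonal_matrix P"
  shows "spectral P f *v column k P = f k *\<^sub>R column k P"
proof -
  have "spectral P f ** P = P ** diagm f ** (transpose P ** P)"
    by (simp only: spectral_def matrix_mul_assoc)
  then have "spectral P f ** P = P ** diagm f"
    using P by (simp add: orthogonal_matrix_def)
  then have "(spectral P f ** P) $ i $ k = (P ** diagm f) $ i $ k" for i by simp
  then show ?thesis
    by (simp add: vec_eq_iff matrix_mult_diagm_nth column_def)
       (simp add: matrix_matrix_mult_def matrix_vector_mult_def)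
qed

text \<open>In the coordinates \<open>transpose P *v v\<close> the eigenvector equation becomes
  diagonal. This turns the set in \<open>lambda_max\<close> into the finite set
  \<open>range f\<close>.\<close>

lemma spectral_eigenvalue_iff:
  fixes P :: "real^'n::finite^'n"
  assumes P: "orthogonal_matrix P"
  shows "(\<exists>v. v \<noteq> 0 \<and> spectral P f *v v = e *\<^sub>R v) \<longleftrightarrow> e \<in> range f"
proof
  assume "\<exists>v. v \<noteq> 0 \<and> spectral P f *v v = e *\<^sub>R v"
  then obtain v where v: "v \<noteq> 0" "spectral P f *v v = e *\<^sub>R v" by blast
  define u where "u = transpose P *v v"
  have PP: "transpose P ** P = mat 1" "P ** transpose P = mat 1" using P by (auto simp: orthogonal_matrix_def)
  have "P *v u = v" unfolding u_def matrix_vector_mul_assoc PP by simp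
  with v(1) have "u \<noteq> 0" by auto
  then obtain k where k: "u $ k \<noteq> 0" by (auto simp: vec_eq_iff)
  have "diagm f *v u = (transpose P ** P) *v (diagm f *v u)" by (simp add: PP)
  also have "\<dots> = transpose P *v (spectral P f *v v)"
    by (simp only: u_def spectral_def matrix_vector_mul_assoc matrix_mul_assoc)
  also have "\<dots> = e *\<^sub>R u" by (simp only: v u_def matrix_vector_mult_scaleR)
  finally have "(diagm f *v u) $ k = e * u $ k" by simp
  moreover have "(diagm f *v u) $ k = f k * u $ k"
    by (simp add: matrix_vector_mult_def diagm_nth if_distrib[of "\<lambda>x. x * _"] cong: if_cong)
  ultimately show "e \<in> range f" using k by auto
next
  assume "e \<in> range f"
  then obtain k where k: "e = f k" by blast
  have "norm (column k P) = 1" using P by (simp add: orthogonal_matrix_orthonormal_columns)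
  then have "column k P \<noteq> 0" by auto
  then show "\<exists>v. v \<noteq> 0 \<and> spectral P f *v v = e *\<^sub>R v"
    using spectral_column[OF P, of f k] k by blast
qed

section \<open>Laplacians and the performance measure\<close>

lemma laplacian_nth:
  "laplacian a $ i $ j = (if i = j then (\<Sum>k\<in>UNIV. a i k) else 0) - a i j"
  by (simp add: laplacian_def degm_def adjm_def diagm_nth)

lemma laplacian_mult_vec_nth:
  "(laplacian a *v x) $ i = (\<Sum>j\<in>UNIV. a i j * (x $ i - x $ j))"
  by (simp add: matrix_vector_mult_def laplacian_nth left_diff_distrib right_diff_distrib sum_subtractf
      sum_distrib_right if_distrib[of "\<lambda>x. x * _"] cong: if_cong)

lemma transpose_laplacian:
  assumes "weighted_graph a"
  shows "transpose (laplacian a) = laplacian a"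
  using assms by (simp add: vec_eq_iff transpose_def laplacian_nth weighted_graph_def)

text \<open>The double sum has a summand antisymmetric in \<open>i\<close> and \<open>j\<close>, so
  it equals its own negative.\<close>

lemma sum_laplacian_mult_vec:
  assumes "weighted_graph a"
  shows "(\<Sum>i\<in>UNIV. (laplacian a *v x) $ i) = 0"
proof -
  let ?s = "\<Sum>i\<in>UNIV. \<Sum>j\<in>UNIV. a i j * (x $ i - x $ j)"
  have "?s = (\<Sum>i\<in>UNIV. \<Sum>j\<in>UNIV. a j i * (x $ j - x $ i))"
    by (rule sum.swap)
  also have "\<dots> = (\<Sum>i\<in>UNIV. \<Sum>j\<in>UNIV. - (a i j * (x $ i - x $ j)))"
    using assms by (intro sum.cong) (auto simp: weighted_graph_def algebra_simps)
  also have "\<dots> = - ?s" by (simp add: sum_negf)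
  finally show ?thesis by (simp add: laplacian_mult_vec_nth)
qed

lemma laplacian_quadratic_form:
  assumes "weighted_graph a"
  shows "2 * (x \<bullet> (laplacian a *v x)) = (\<Sum>i\<in>UNIV. \<Sum>j\<in>UNIV. a i j * (x $ i - x $ j)\<^sup>2)"
proof -
  let ?s = "\<Sum>i\<in>UNIV. \<Sum>j\<in>UNIV. x $ i * (a i j * (x $ i - x $ j))"
  have 1: "x \<bullet> (laplacian a *v x) = ?s"
    by (simp add: inner_vec_def laplacian_mult_vec_nth sum_distrib_left)
  have "?s = (\<Sum>i\<in>UNIV. \<Sum>j\<in>UNIV. x $ j * (a j i * (x $ j - x $ i)))"
    by (rule sum.swap)
  also have "\<dots> = (\<Sum>i\<in>UNIV. \<Sum>j\<in>UNIV. x $ j * (a i j * (x $ j - x $ i)))"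
    using assms by (intro sum.cong) (auto simp: weighted_graph_def)
  finally have "2 * ?s = ?s + (\<Sum>i\<in>UNIV. \<Sum>j\<in>UNIV. x $ j * (a i j * (x $ j - x $ i)))"
    by simp
  also have "\<dots> = (\<Sum>i\<in>UNIV. \<Sum>j\<in>UNIV. a i j * (x $ i - x $ j)\<^sup>2)"
    unfolding sum.distrib[symmetric]
    by (intro sum.cong) (auto simp: power2_eq_square algebra_simps)
  finally show ?thesis unfolding 1 .
qed

lemma laplacian_psd:
  assumes "weighted_graph a"
  shows "x \<bullet> (laplacian a *v x) \<ge> 0"
proof -
  have "0 \<le> (\<Sum>i\<in>UNIV. \<Sum>j\<in>UNIV. a i j * (x $ i - x $ j)\<^sup>2)"
    using assms by (intro sum_nonneg mult_nonneg_nonneg) (auto simp: weighted_graph_def)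
  then show ?thesis using laplacian_quadratic_form[OF assms, of x] by simp
qed

text \<open>A kernel vector makes the quadratic form vanish, so its entries agree across every edge;
  connectedness propagates the equality along paths.\<close>

lemma laplacian_kernel_constant:
  assumes a: "weighted_graph a" and conn: "graph_connected a" and ker: "laplacian a *v x = 0"
  shows "x $ i = x $ j"
proof -
  have nn: "a i j * (x $ i - x $ j)\<^sup>2 \<ge> 0" for i j
    using a by (simp add: weighted_graph_def)
  have "(\<Sum>i\<in>UNIV. \<Sum>j\<in>UNIV. a i j * (x $ i - x $ j)\<^sup>2) = 0"
    using laplacian_quadratic_form[OF a, of x] ker by simp
  then have "a i j * (x $ i - x $ j)\<^sup>2 = 0" for i j
    using nn by (simp add: sum_nonneg_eq_0_iff sum_nonneg)
  then have edge: "x $ i = x $ j" if "a i j > 0" for i j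
    using that by (metis less_irrefl mult_eq_0_iff power2_eq_iff_nonneg right_minus_eq zero_eq_power2)
  have "(i, j) \<in> {(u, v). a u v > 0}\<^sup>*"
    using conn by (simp add: graph_connected_def)
  then show ?thesis
    by (induction rule: rtrancl_induct) (auto dest: edge)
qed

text \<open>Checked on each eigenvector: for eigenvalue zero the column is constant and is
  annihilated, while for a nonzero eigenvalue its entries sum to zero and it is fixed.\<close>

lemma centering_spectral:
  fixes a :: "'n::finite \<Rightarrow> 'n \<Rightarrow> real"
  assumes a: "weighted_graph a" "graph_connected a"
    and P: "orthogonal_matrix P" and L: "laplacian a = spectral P d"
  shows "centering = spectral P (\<lambda>k. if d k = 0 then 0 else 1)"
proof -
  let ?m = "\<lambda>k. if d k = 0 then 0 else 1 :: real"
  have eig: "laplacian a *v column k P = d k *\<^sub>R column k P" for k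
    unfolding L by (rule spectral_column[OF P])
  have "(centering ** P) $ i $ k = (P ** diagm ?m) $ i $ k" for i k
  proof -
    have "(centering ** P) $ i $ k = P $ i $ k - (\<Sum>j\<in>UNIV. P $ j $ k) / real CARD('n)"
      by (simp add: centering_def matrix_matrix_mult_def left_diff_distrib sum_subtractf sum_divide_distrib
          if_distrib[of "\<lambda>x. x * _"] cong: if_cong)
    also have "\<dots> = P $ i $ k * ?m k"
    proof (cases "d k = 0")
      case True
      then have "column k P $ i = column k P $ j" for j
        using eig[of k] by (intro laplacian_kernel_constant[OF a]) simp
      then have "P $ j $ k = P $ i $ k" for j by (metis column_def vec_lambda_beta)
      then have "(\<Sum>j\<in>UNIV. P $ j $ k) = (\<Sum>j\<in>(UNIV :: 'n set). P $ i $ k)"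
        by (rule sum.cong[OF refl])
      with True show ?thesis by simp
    next
      case False
      have "d k * (\<Sum>j\<in>UNIV. P $ j $ k) = (\<Sum>j\<in>UNIV. (laplacian a *v column k P) $ j)"
        unfolding eig by (simp add: column_def sum_distrib_left)
      also have "\<dots> = 0" by (rule sum_laplacian_mult_vec[OF a(1)])
      finally show ?thesis using False by simp
    qed
    finally show ?thesis by (simp add: matrix_mult_diagm_nth)
  qed
  then have "centering ** P = P ** diagm ?m" by (simp add: vec_eq_iff)
  then have "centering ** (P ** transpose P) = spectral P ?m"
    by (simp add: spectral_def matrix_mul_assoc)
  then show ?thesis using P by (simp add: orthogonal_matrix_def)
qed

section \<open>The frequency integrand and the value of the performance\<close>

text \<open>The squared norm of column \<open>j\<close> is the diagonal entry \<open>(j, j)\<close>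
  of the conjugate transpose times the matrix. Since \<open>P\<close> is real, conjugation only
  affects \<open>f\<close>, and the product is again spectral, with eigenvalues
  \<open>|f k|^2\<close>.\<close>

lemma sum_norm_spectral_column:
  assumes P: "orthogonal_matrix P"
  shows "(\<Sum>i\<in>UNIV. (norm (spectral (cmat P) f $ i $ j))\<^sup>2) = (\<Sum>k\<in>UNIV. (P $ j $ k)\<^sup>2 * (norm (f k))\<^sup>2)"
proof -
  have cnj: "cnj (spectral (cmat P) f $ i $ j) = spectral (cmat P) (\<lambda>k. cnj (f k)) $ j $ i" for i j
    by (simp add: spectral_nth cmat_def ac_simps)
  have "complex_of_real (\<Sum>i\<in>UNIV. (norm (spectral (cmat P) f $ i $ j))\<^sup>2) =
      (\<Sum>i\<in>UNIV. spectral (cmat P) (\<lambda>k. cnj (f k)) $ j $ i * spectral (cmat P) f $ i $ j)"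
    by (simp add: complex_norm_square cnj mult.commute del: of_real_power)
  also have "\<dots> = (spectral (cmat P) (\<lambda>k. cnj (f k)) ** spectral (cmat P) f) $ j $ j"
    by (simp add: matrix_matrix_mult_def)
  also have "\<dots> = spectral (cmat P) (\<lambda>k. of_real ((norm (f k))\<^sup>2)) $ j $ j"
    by (simp add: spectral_mult[OF orthogonal_matrix_cmat[OF P]] complex_norm_square mult.commute
        del: of_real_power)
  also have "\<dots> = of_real (\<Sum>k\<in>UNIV. (P $ j $ k)\<^sup>2 * (norm (f k))\<^sup>2)"
    by (simp add: spectral_nth cmat_def power2_eq_square ac_simps)
  finally show ?thesis using of_real_eq_iff by blast
qed

lemma Re_trace_conj_transpose_mult:
  "Re (trace (conj_transpose G ** G)) = (\<Sum>j\<in>UNIV. \<Sum>i\<in>UNIV. (norm (G $ i $ j))\<^sup>2)"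
  by (simp add: trace_def conj_transpose_def matrix_matrix_mult_def transpose_def cmod_power2
      power2_eq_square[of "Re _"] power2_eq_square[of "Im _"])

lemma cmat_diagm: "cmat (diagm f) = diagm (\<lambda>i. of_real (f i))"
  by (simp add: vec_eq_iff cmat_def diagm_nth)

text \<open>The zero eigenvalue would contribute the unbounded mode \<open>1 / s\<close>, which the
  centering matrix removes; this is the zero branch of the conditional. The two diagonal factors on
  the right only scale column \<open>j\<close>.\<close>

lemma transfer_nth_spectral:
  fixes a :: "'n::finite \<Rightarrow> 'n \<Rightarrow> real"
  assumes a: "weighted_graph a" "graph_connected a"
    and P: "orthogonal_matrix P" and L: "laplacian a = spectral P d"
    and nz: "\<And>k. delay_char (d k) \<tau> s \<noteq> 0"
  shows "transfer a \<tau> \<sigma> s $ i $ j =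
     spectral (cmat P) (\<lambda>k. if d k = 0 then 0 else inverse (delay_char (d k) \<tau> s)) $ i $ j
       * of_real ((\<Sum>k\<in>UNIV. a j k) * \<sigma> $ j)"
proof -
  note P' = orthogonal_matrix_cmat[OF P]
  let ?e = "exp (- complex_of_real \<tau> * s)"
  have "mat s + mat ?e ** cmat (laplacian a) = spectral (cmat P) (\<lambda>k. delay_char (d k) \<tau> s)"
    unfolding L cmat_spectral spectral_const[OF P', symmetric] spectral_mult[OF P'] spectral_add
    by (simp add: delay_char_def mult.commute)
  then have "cmat centering ** matrix_inv (mat s + mat ?e ** cmat (laplacian a)) =
      spectral (cmat P) (\<lambda>k. if d k = 0 then 0 else inverse (delay_char (d k) \<tau> s))"
    by (simp add: matrix_inv_spectral[OF P' nz] centering_spectral[OF a P L] cmat_spectral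
        spectral_mult[OF P'] if_distrib if_distribR cong: if_cong)
  then show ?thesis
    by (simp add: transfer_def degm_def cmat_diagm matrix_mult_diagm_nth)
qed

lemma Re_trace_transfer:
  fixes a :: "'n::finite \<Rightarrow> 'n \<Rightarrow> real"
  assumes a: "weighted_graph a" "graph_connected a"
    and P: "orthogonal_matrix P" and L: "laplacian a = spectral P d"
    and nz: "\<And>k. delay_char (d k) \<tau> s \<noteq> 0"
  shows "Re (trace (conj_transpose (transfer a \<tau> \<sigma> s) ** transfer a \<tau> \<sigma> s)) =
    (\<Sum>j\<in>UNIV. ((\<Sum>k\<in>UNIV. a j k) * \<sigma> $ j)\<^sup>2 *
       (\<Sum>k\<in>UNIV. (P $ j $ k)\<^sup>2 * (if d k = 0 then 0 else 1 / (norm (delay_char (d k) \<tau> s))\<^sup>2)))"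
proof -
  let ?f = "\<lambda>k. if d k = 0 then 0 else inverse (delay_char (d k) \<tau> s)"
  have f: "(norm (?f k))\<^sup>2 = (if d k = 0 then 0 else 1 / (norm (delay_char (d k) \<tau> s))\<^sup>2)" for k
    by (simp add: norm_inverse power_inverse divide_inverse)
  have "(\<Sum>i\<in>UNIV. (norm (transfer a \<tau> \<sigma> s $ i $ j))\<^sup>2) =
      ((\<Sum>k\<in>UNIV. a j k) * \<sigma> $ j)\<^sup>2 * (\<Sum>i\<in>UNIV. (norm (spectral (cmat P) ?f $ i $ j))\<^sup>2)" for j
    unfolding transfer_nth_spectral[OF a P L nz]
    by (simp add: norm_mult power_mult_distrib sum_distrib_left ac_simps del: of_real_mult of_real_sum)
  then show ?thesis
    unfolding Re_trace_conj_transpose_mult sum_norm_spectral_column[OF P] f by simp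
qed

lemma eigenvalue_le_lambda_max:
  assumes P: "orthogonal_matrix P"
  shows "d k \<le> lambda_max (spectral P d)"
  unfolding lambda_max_def spectral_eigenvalue_iff[OF P] by simp

lemma laplacian_eigenvalue_nonneg:
  assumes a: "weighted_graph a" and P: "orthogonal_matrix P" and L: "laplacian a = spectral P d"
  shows "d k \<ge> 0"
proof -
  have "norm (column k P) = 1" using P by (simp add: orthogonal_matrix_orthonormal_columns)
  then have "column k P \<bullet> column k P = 1" by (simp add: norm_eq_1)
  then have "column k P \<bullet> (laplacian a *v column k P) = d k"
    by (simp add: L spectral_column[OF P])
  then show ?thesis using laplacian_psd[OF a] by metis
qed

lemma rho_ss_spectral:
  fixes a :: "'n::finite \<Rightarrow> 'n \<Rightarrow> real"
  assumes a: "weighted_graph a" "graph_connected a"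
    and P: "orthogonal_matrix P" and L: "laplacian a = spectral P d"
    and \<tau>: "\<tau> \<ge> 0" "\<tau> * lambda_max (laplacian a) < pi / 2"
  shows "rho_ss a \<tau> \<sigma> = 1/2 * (\<Sum>j\<in>UNIV. ((\<Sum>k\<in>UNIV. a j k) * \<sigma> $ j)\<^sup>2 *
       (\<Sum>k\<in>UNIV. (P $ j $ k)\<^sup>2 * (cos (\<tau> * d k) / (d k * (1 - sin (\<tau> * d k))))))"
proof -
  let ?\<phi> = "\<lambda>k. pi * cos (\<tau> * d k) / (d k * (1 - sin (\<tau> * d k)))"
  let ?f = "\<lambda>w k. if d k = 0 then 0 else 1 / (norm (delay_char (d k) \<tau> (\<i> * of_real w)))\<^sup>2"
  have d0: "d k \<ge> 0" for k by (rule laplacian_eigenvalue_nonneg[OF a(1) P L])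
  have stable: "\<tau> * d k < pi / 2" for k
  proof -
    have "\<tau> * d k \<le> \<tau> * lambda_max (laplacian a)"
      unfolding L using eigenvalue_le_lambda_max[OF P] \<tau>(1) by (rule mult_left_mono)
    with \<tau>(2) show ?thesis by simp
  qed
  \<comment> \<open>For \<open>d k = 0\<close> the integrand is zero, and so is the stated value,
    because division by zero yields zero.\<close>
  have "((\<lambda>w. ?f w k) has_integral ?\<phi> k) UNIV" for k
    using has_integral_inverse_delay_char[OF _ \<tau>(1) stable, of k] d0[of k] by (cases "d k = 0") auto
  then have "((\<lambda>w. \<Sum>j\<in>UNIV. ((\<Sum>k\<in>UNIV. a j k) * \<sigma> $ j)\<^sup>2 * (\<Sum>k\<in>UNIV. (P $ j $ k)\<^sup>2 * ?f w k)) has_integral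
      (\<Sum>j\<in>UNIV. ((\<Sum>k\<in>UNIV. a j k) * \<sigma> $ j)\<^sup>2 * (\<Sum>k\<in>UNIV. (P $ j $ k)\<^sup>2 * ?\<phi> k))) UNIV"
    by (intro has_integral_sum has_integral_mult_right) auto
  then have "((\<lambda>w. Re (trace (conj_transpose (transfer a \<tau> \<sigma> (\<i> * of_real w)) ** transfer a \<tau> \<sigma> (\<i> * of_real w))))
      has_integral (\<Sum>j\<in>UNIV. ((\<Sum>k\<in>UNIV. a j k) * \<sigma> $ j)\<^sup>2 * (\<Sum>k\<in>UNIV. (P $ j $ k)\<^sup>2 * ?\<phi> k))) UNIV"
  \<comment> \<open>At frequency zero the zero eigenvalue makes the matrix to be inverted singular,
    so that single point is excepted.\<close>
  proof (rule has_integral_spike_finite[rotated 2])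
    show "finite {0 :: real}" by simp
    fix w :: real assume w: "w \<in> UNIV - {0}"
    have "delay_char (d k) \<tau> (\<i> * of_real w) \<noteq> 0" for k
    proof (cases "d k = 0")
      case True
      then show ?thesis using w by (simp add: delay_char_def)
    next
      case False
      then show ?thesis using d0[of k] \<tau>(1) stable by (intro delay_char_nonzero) auto
    qed
    then show "Re (trace (conj_transpose (transfer a \<tau> \<sigma> (\<i> * of_real w)) ** transfer a \<tau> \<sigma> (\<i> * of_real w))) =
      (\<Sum>j\<in>UNIV. ((\<Sum>k\<in>UNIV. a j k) * \<sigma> $ j)\<^sup>2 * (\<Sum>k\<in>UNIV. (P $ j $ k)\<^sup>2 * ?f w k))"
      by (rule Re_trace_transfer[OF a P L])
  qed
  then have "rho_ss a \<tau> \<sigma> = 1 / (2 * pi) *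
      (\<Sum>j\<in>UNIV. ((\<Sum>k\<in>UNIV. a j k) * \<sigma> $ j)\<^sup>2 * (\<Sum>k\<in>UNIV. (P $ j $ k)\<^sup>2 * ?\<phi> k))"
    unfolding rho_ss_def by (simp add: integral_unique)
  also have "\<dots> = 1/2 * (\<Sum>j\<in>UNIV. ((\<Sum>k\<in>UNIV. a j k) * \<sigma> $ j)\<^sup>2 *
       (\<Sum>k\<in>UNIV. (P $ j $ k)\<^sup>2 * (cos (\<tau> * d k) / (d k * (1 - sin (\<tau> * d k))))))"
    unfolding sum_distrib_left by (intro sum.cong) (auto simp: field_simps)
  finally show ?thesis .
qed

text \<open>The partial derivative varies only the intensity of agent \<open>i\<close>. It is taken
  within \<open>{0..}\<close> because intensities are nonnegative; at \<open>q $ i = 0\<close> it is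
  the one-sided derivative.\<close>

theorem theorem7:
  fixes a :: "'n::finite \<Rightarrow> 'n \<Rightarrow> real" and \<tau> :: real and q :: "real^'n" and i :: 'n
  assumes "weighted_graph a" and "graph_connected a"
    and "\<tau> \<ge> 0" and "\<tau> * lambda_max (laplacian a) < pi / 2"
    and "\<forall>k. q $ k \<ge> 0"
  shows "((\<lambda>t. rho_ss_var a \<tau> (\<chi> k. if k = i then t else q $ k))
            has_real_derivative
          (1/2) * (degm a ** degm a ** pinv (laplacian a) ** mcos (\<tau> *\<^sub>R laplacian a)
                   ** pinv (centering - msin (\<tau> *\<^sub>R laplacian a))) $ i $ i)
         (at (q $ i) within {0..})"
proof -
  obtain P d where P: "orthogonal_matrix P" and L: "laplacian a = spectral P d"
    using symmetric_matrix_spectral[OF transpose_laplacian[OF assms(1)]] by blast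
  define deg where "deg j = (\<Sum>k\<in>UNIV. a j k)" for j
  define \<phi> where "\<phi> k = cos (\<tau> * d k) / (d k * (1 - sin (\<tau> * d k)))" for k
  define \<Phi> where "\<Phi> j = (deg j)\<^sup>2 * (\<Sum>k\<in>UNIV. (P $ j $ k)\<^sup>2 * \<phi> k)" for j
  have "pinv (laplacian a) ** mcos (\<tau> *\<^sub>R laplacian a) ** pinv (centering - msin (\<tau> *\<^sub>R laplacian a)) =
      spectral P (\<lambda>k. inverse (d k) * cos (\<tau> * d k) * inverse ((if d k = 0 then 0 else 1) - sin (\<tau> * d k)))"
    unfolding centering_spectral[OF assms(1,2) P L] L
    by (simp add: spectral_scaleR pinv_spectral[OF P] mcos_spectral[OF P] msin_spectral[OF P]
        spectral_diff spectral_mult[OF P])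
  \<comment> \<open>The conditional disappears: on the zero mode the factor
    \<open>inverse (d k) = 0\<close> already kills the product, and on all others the centering
    matrix acts as \<open>1\<close>.\<close>
  also have "\<dots> = spectral P \<phi>"
    by (rule arg_cong[where f = "spectral P"]) (auto simp: \<phi>_def fun_eq_iff divide_inverse)
  finally have "degm a ** degm a ** pinv (laplacian a) ** mcos (\<tau> *\<^sub>R laplacian a)
      ** pinv (centering - msin (\<tau> *\<^sub>R laplacian a)) = degm a ** (degm a ** spectral P \<phi>)"
    by (metis matrix_mul_assoc)
  moreover have "(degm a ** X) $ i $ j = deg i * X $ i $ j" for X :: "real^'n^'n" and i j
    by (simp add: degm_def deg_def matrix_matrix_mult_def diagm_nth if_distrib[of "\<lambda>x. x * _"] cong: if_cong)
  ultimately have rhs: "(degm a ** degm a ** pinv (laplacian a) ** mcos (\<tau> *\<^sub>R laplacian a)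
      ** pinv (centering - msin (\<tau> *\<^sub>R laplacian a))) $ i $ i = \<Phi> i"
    by (simp add: \<Phi>_def spectral_nth power2_eq_square ac_simps)
  \<comment> \<open>Squaring undoes the square root only for nonnegative intensities; there the
    performance is linear with coefficients \<open>\<Phi> j / 2\<close>.\<close>
  have rho: "rho_ss_var a \<tau> r = 1/2 * (\<Sum>j\<in>UNIV. r $ j * \<Phi> j)" if "\<And>k. r $ k \<ge> 0" for r
    unfolding rho_ss_var_def rho_ss_spectral[OF assms(1,2) P L assms(3,4)]
    using that by (simp add: \<Phi>_def \<phi>_def deg_def power_mult_distrib ac_simps)
  define C where "C = (\<Sum>j\<in>UNIV - {i}. q $ j * \<Phi> j)"
  have eq: "1/2 * (t * \<Phi> i + C) = rho_ss_var a \<tau> (\<chi> k. if k = i then t else q $ k)" if "t \<in> {0..}" for t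
  proof -
    have "(\<Sum>j\<in>UNIV. (\<chi> k. if k = i then t else q $ k) $ j * \<Phi> j) = t * \<Phi> i + C"
      by (subst sum.remove[of _ i]) (auto simp: C_def)
    moreover have "rho_ss_var a \<tau> (\<chi> k. if k = i then t else q $ k) =
        1/2 * (\<Sum>j\<in>UNIV. (\<chi> k. if k = i then t else q $ k) $ j * \<Phi> j)"
      using that assms(5) by (intro rho) simp
    ultimately show ?thesis by simp
  qed
  have "((\<lambda>t. 1/2 * (t * \<Phi> i + C)) has_real_derivative 1/2 * \<Phi> i) (at (q $ i) within {0..})"
    by (auto intro!: derivative_eq_intros)
  then show ?thesis
    unfolding rhs
    \<comment> \<open>The two functions agree on all of \<open>{0..}\<close>, so the radius
      \<open>1\<close> is an arbitrary choice.\<close>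
    by (rule has_field_derivative_transform_within[OF _ zero_less_one]) (use eq assms(5) in auto)
qed

end
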